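(* Suppose that $k \ge r_1 \ge r_2 > i \ge 1$ are integers. Then \[ \left( \frac{\Phi_{k,r_1,i}}{\binom{k-i}{r_1-i}} \right)^{1/(r_1-i)} \le \left( \frac{\Phi_{k,r_2,i}}{\binom{k-i}{r_2-i}} \right)^{1/(r_2-i)}. \]
   Context: An $r$-graph $\mathcal{H}$ is a collection of $r$-element subsets (edges) of a finite vertex set $V(\mathcal{H})$; a vertex is isolated if it lies in no edge. For $1\le i<r$, let $\partial_{r-i}\mathcal{H}$ denote the set of $i$-subsets of $V(\mathcal{H})$ contained in some edge. For an $i$-set $S$, $d_{\mathcal{H}}(S)$ is the number of $(r-i)$-sets $T$ with $S\cup T\in\mathcal{H}$ (and $S\cap T=\emptyset$). The positive minimum $i$-degree is $\delta^{+}_{i}(\mathcal{H}) = \min\{d_{\mathcal{H}}(S) : S\in\partial_{r-i}\mathcal{H}\}$. A $k$-coloring of $\mathcal{H}$ is a map $V(\mathcal{H})\to[k]$ injective on every edge; $\mathcal{H}$ is $k$-partite if it has one. Two $k$-colorings $\varphi,\vartheta$ are equivalent if $\vartheta=\eta\circ\varphi$ for a permutation $\eta$ of $[k]$; $\mathcal{H}$ is uniquely $k$-colorable if it is $k$-colorable and any two $k$-colorings are equivalent. For integers $k\ge r>i\ge1$, $\Phi_{k,r,i}$ is the minimum real number such that for every $n\ge k$, every $n$-vertex $k$-partite $r$-graph $\mathcal{H}$ without isolated vertices and with $\delta^{+}_{i}(\mathcal{H}) > \Phi_{k,r,i}\, n^{r-i}$ is uniquely $k$-colorable. *)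

theory Defs
  imports Complex_Main "HOL-Combinatorics.Permutations"
begin

definition rgraph :: "nat \<Rightarrow> 'a set \<Rightarrow> 'a set set \<Rightarrow> bool" where
  "rgraph r V E \<longleftrightarrow> finite V \<and> (\<forall>e\<in>E. e \<subseteq> V \<and> card e = r)"

definition no_isolated :: "'a set \<Rightarrow> 'a set set \<Rightarrow> bool" where
  "no_isolated V E \<longleftrightarrow> (\<forall>v\<in>V. \<exists>e\<in>E. v \<in> e)"

text \<open>The set of \<open>i\<close>-subsets of vertices contained in some edge; for an \<open>r\<close>-graph this is
  usually written \<open>\<partial>\<^bsub>r-i\<^esub>\<close>. The parameter here is the size \<open>i\<close> of the members.\<close>

definition shadow_sets :: "nat \<Rightarrow> 'a set \<Rightarrow> 'a set set \<Rightarrow> 'a set set" where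
  "shadow_sets i V E = {S. S \<subseteq> V \<and> card S = i \<and> (\<exists>e\<in>E. S \<subseteq> e)}"

definition set_degree :: "nat \<Rightarrow> 'a set \<Rightarrow> 'a set set \<Rightarrow> 'a set \<Rightarrow> nat" where
  "set_degree r V E S =
     card {T. T \<subseteq> V \<and> card T = r - card S \<and> S \<inter> T = {} \<and> S \<union> T \<in> E}"

definition pos_min_degree :: "nat \<Rightarrow> nat \<Rightarrow> 'a set \<Rightarrow> 'a set set \<Rightarrow> nat" where
  "pos_min_degree r i V E = Min (set_degree r V E ` shadow_sets i V E)"

text \<open>A coloring is only relevant on \<open>V\<close>; its values elsewhere are arbitrary.\<close>

definition is_coloring :: "nat \<Rightarrow> 'a set \<Rightarrow> 'a set set \<Rightarrow> ('a \<Rightarrow> nat) \<Rightarrow> bool" where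
  "is_coloring k V E \<phi> \<longleftrightarrow> \<phi> ` V \<subseteq> {1..k} \<and> (\<forall>e\<in>E. inj_on \<phi> e)"

definition k_partite :: "nat \<Rightarrow> 'a set \<Rightarrow> 'a set set \<Rightarrow> bool" where
  "k_partite k V E \<longleftrightarrow> (\<exists>\<phi>. is_coloring k V E \<phi>)"

definition equivalent_colorings ::
    "nat \<Rightarrow> 'a set \<Rightarrow> ('a \<Rightarrow> nat) \<Rightarrow> ('a \<Rightarrow> nat) \<Rightarrow> bool" where
  "equivalent_colorings k V \<phi> \<theta> \<longleftrightarrow>
     (\<exists>\<eta>. \<eta> permutes {1..k} \<and> (\<forall>v\<in>V. \<theta> v = \<eta> (\<phi> v)))"

definition uniquely_colorable :: "nat \<Rightarrow> 'a set \<Rightarrow> 'a set set \<Rightarrow> bool" where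
  "uniquely_colorable k V E \<longleftrightarrow> k_partite k V E \<and>
     (\<forall>\<phi> \<theta>. is_coloring k V E \<phi> \<longrightarrow> is_coloring k V E \<theta> \<longrightarrow> equivalent_colorings k V \<phi> \<theta>)"

text \<open>All notions are isomorphism invariant, so vertex sets may be taken to be
  arbitrary finite sets of naturals.\<close>

definition forces_unique :: "nat \<Rightarrow> nat \<Rightarrow> nat \<Rightarrow> real \<Rightarrow> bool" where
  "forces_unique k r i c \<longleftrightarrow>
     (\<forall>n\<ge>k. \<forall>(V :: nat set) E.
        rgraph r V E \<and> card V = n \<and> k_partite k V E \<and> no_isolated V E \<and>
        real (pos_min_degree r i V E) > c * real n ^ (r - i)
        \<longrightarrow> uniquely_colorable k V E)"

definition Phi :: "nat \<Rightarrow> nat \<Rightarrow> nat \<Rightarrow> real" where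
  "Phi k r i = (LEAST c. forces_unique k r i c)"

text \<open>The minimum is attained, so \<open>LEAST\<close> is well defined in the intended range of parameters.\<close>

lemma ex_not_uniquely_colorable:
  assumes "k \<ge> r" "r \<ge> 2"
  shows "\<exists>(V :: nat set) E. rgraph r V E \<and> card V \<ge> k \<and> k_partite k V E \<and> no_isolated V E \<and>
           \<not> uniquely_colorable k V E"
proof -
  define V where "V = {..<r * k}"
  define B where "B = (\<lambda>j. {v. v div r = j})"
  define E where "E = B ` {..<k}"
  define \<phi> where "\<phi> = (\<lambda>v. v mod r + 1)"
  define \<theta> where "\<theta> = (\<lambda>v. if v = 0 then 2 else if v = 1 then 1 else v mod r + 1)"
  have r0: "r > 0" using assms by simp
  have B: "B j = {r * j..<r * j + r}" for j
  proof -
    have "v div r = j \<longleftrightarrow> r * j \<le> v \<and> v < r * j + r" for v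
    proof
      assume "v div r = j"
      then have "v = r * j + v mod r" by (metis mult_div_mod_eq)
      then show "r * j \<le> v \<and> v < r * j + r" using mod_less_divisor[OF r0, of v] by linarith
    next
      assume "r * j \<le> v \<and> v < r * j + r"
      then show "v div r = j" by (intro div_nat_eqI) (auto simp: mult.commute)
    qed
    then show ?thesis unfolding B_def by (intro set_eqI) (simp only: mem_Collect_eq atLeastLessThan_iff)
  qed
  have inV: "v < r * k \<longleftrightarrow> v div r < k" for v
    using r0 div_less_iff_less_mult[of r v k] by (simp only: mult.commute[of r k])
  have rg: "rgraph r V E"
    unfolding rgraph_def
  proof (intro conjI ballI)
    show "finite V" by (simp add: V_def)
    fix e assume "e \<in> E"
    then obtain j where j: "j < k" "e = B j" by (auto simp: E_def)
    show "e \<subseteq> V" using j by (auto simp: B_def V_def inV)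
    show "card e = r" using j B by simp
  qed
  have iso: "no_isolated V E"
    unfolding no_isolated_def by (auto simp: V_def E_def B_def inV)
  have mod_eq: "v = w" if "v mod r = w mod r" "v div r = w div r" for v w
    using that by (metis div_mult_mod_eq)
  have modk: "v mod r + 1 \<le> k" for v
    using mod_less_divisor[OF r0, of v] assms(1) by linarith
  have c1: "is_coloring k V E \<phi>"
  proof -
    have "\<phi> v \<in> {1..k}" for v
      using modk[of v] by (simp add: \<phi>_def)
    moreover have "inj_on \<phi> (B j)" for j
      by (rule inj_onI, rule mod_eq) (auto simp: \<phi>_def B_def)
    ultimately show ?thesis by (auto simp: is_coloring_def E_def)
  qed
  have c2: "is_coloring k V E \<theta>"
  proof -
    have "\<theta> v \<in> {1..k}" for v
      using modk[of v] assms by (auto simp: \<theta>_def)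
    moreover have "inj_on \<theta> (B j)" for j
    proof (cases "j = 0")
      case True
      then show ?thesis using B[of 0] by (auto simp: inj_on_def \<theta>_def)
    next
      case False
      have "\<theta> v = \<phi> v" if "v \<in> B j" for v
      proof -
        have d: "v div r \<noteq> 0" using that False by (simp add: B_def)
        have "v \<noteq> 0" using d by (metis div_0)
        moreover have "v \<noteq> 1" using d assms(2) by (intro notI) simp
        ultimately have "v \<noteq> 0" "v \<noteq> 1" by blast+
        then show ?thesis by (simp add: \<theta>_def \<phi>_def)
      qed
      moreover have "inj_on \<phi> (B j)"
        by (rule inj_onI, rule mod_eq) (auto simp: \<phi>_def B_def)
      ultimately show ?thesis by (simp cong: inj_on_cong)
    qed
    ultimately show ?thesis by (auto simp: is_coloring_def E_def)
  qed
  have "0 \<in> V" "r \<in> V" using assms by (auto simp: V_def)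
  moreover have "\<phi> 0 = \<phi> r" "\<theta> 0 \<noteq> \<theta> r" using assms by (auto simp: \<phi>_def \<theta>_def)
  ultimately have "\<not> equivalent_colorings k V \<phi> \<theta>"
    unfolding equivalent_colorings_def by metis
  then have "\<not> uniquely_colorable k V E" using c1 c2 by (auto simp: uniquely_colorable_def)
  moreover have "card V \<ge> k" using r0 by (simp add: V_def)
  ultimately show ?thesis using rg iso c1 unfolding k_partite_def by blast
qed

lemma pos_min_degree_le:
  assumes rg: "rgraph r V E" and iso: "no_isolated V E" and ne: "V \<noteq> {}" and ir: "i < r"
  shows "pos_min_degree r i V E \<le> card V ^ (r - i)"
proof -
  have fV: "finite V" using rg by (simp add: rgraph_def)
  obtain e where e: "e \<in> E" using iso ne by (auto simp: no_isolated_def)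
  then have "card e = r" "e \<subseteq> V" using rg by (auto simp: rgraph_def)
  then obtain S where S: "S \<subseteq> e" "card S = i"
    using ir by (metis less_imp_le obtain_subset_with_card_n)
  then have Sh: "S \<in> shadow_sets i V E" using e \<open>e \<subseteq> V\<close> by (auto simp: shadow_sets_def)
  have "finite (shadow_sets i V E)"
    by (rule finite_subset[of _ "Pow V"]) (auto simp: shadow_sets_def fV)
  then have "pos_min_degree r i V E \<le> set_degree r V E S"
    unfolding pos_min_degree_def using Sh by (intro Min_le) auto
  also have "\<dots> \<le> card {T. T \<subseteq> V \<and> card T = r - i}"
    unfolding set_degree_def using S fV by (intro card_mono) auto
  also have "\<dots> = card V choose (r - i)" by (rule n_subsets[OF fV])
  also have "\<dots> \<le> card V ^ (r - i)"
    by (cases "r - i \<le> card V") (auto simp: binomial_le_pow binomial_eq_0)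
  finally show ?thesis .
qed

lemma Phi_is_minimum:
  assumes kr: "k \<ge> r" and ri: "r > i" and i1: "i \<ge> 1"
  shows "forces_unique k r i (Phi k r i)"
    and "forces_unique k r i c \<Longrightarrow> Phi k r i \<le> c"
proof -
  define X where "X = {real (pos_min_degree r i V E) / real (card V) ^ (r - i) | (V :: nat set) E.
    rgraph r V E \<and> card V \<ge> k \<and> k_partite k V E \<and> no_isolated V E \<and> \<not> uniquely_colorable k V E}"
  have k0: "k > 0" using assms by simp
  have fu: "forces_unique k r i c \<longleftrightarrow> (\<forall>x\<in>X. x \<le> c)" for c
  proof -
    have *: "real (pos_min_degree r i V E) / real (card V) ^ (r - i) \<le> c \<longleftrightarrow>
      \<not> real (pos_min_degree r i V E) > c * real (card V) ^ (r - i)"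
      if "card V \<ge> k" for V :: "nat set" and E
    proof -
      have "real (card V) ^ (r - i) > 0" using that k0 by simp
      then show ?thesis by (simp add: pos_divide_le_eq not_less)
    qed
    show ?thesis unfolding forces_unique_def X_def using * by blast
  qed
  have ne: "X \<noteq> {}" using ex_not_uniquely_colorable[of r k] assms by (auto simp: X_def)
  have "\<forall>x\<in>X. x \<le> 1"
  proof
    fix x assume "x \<in> X"
    then obtain V E where VE: "x = real (pos_min_degree r i V E) / real (card V) ^ (r - i)"
      "rgraph r V E" "card (V :: nat set) \<ge> k" "no_isolated V E" by (auto simp: X_def)
    have "V \<noteq> {}" using VE k0 by auto
    from pos_min_degree_le[OF VE(2,4) this ri]
    have "real (pos_min_degree r i V E) \<le> real (card V) ^ (r - i)"
      by (metis of_nat_le_iff of_nat_power)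
    then show "x \<le> 1" using VE(3) k0 by (simp add: VE(1) divide_le_eq_1)
  qed
  then have bdd: "bdd_above X" by (auto simp: bdd_above_def)
  have P: "Phi k r i = Sup X"
    unfolding Phi_def fu using bdd ne by (intro Least_equality) (auto intro: cSup_upper cSup_least)
  show "forces_unique k r i (Phi k r i)" unfolding P fu using bdd by (auto intro: cSup_upper)
  show "Phi k r i \<le> c" if "forces_unique k r i c"
    using that ne unfolding P fu by (auto intro: cSup_least)
qed

end

theory Submission
  imports Defs "HOL-Analysis.Convex"
begin

text \<open>Passing from an \<open>r\<^sub>1\<close>-graph to the \<open>r\<^sub>2\<close>-sets contained in its edges changes neither the
  colourings, because \<open>r\<^sub>2 \<ge> 2\<close>, nor the \<open>i\<close>-sets of positive degree. The link of an \<open>i\<close>-set is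
  \<open>(k - i)\<close>-partite, so the degrees before and after are compared by a coloured Kruskal-Katona
  inequality: if \<open>f\<^sub>j\<close> counts the \<open>j\<close>-sets below an \<open>m\<close>-partite family of \<open>s\<close>-sets,
  then \<open>(f\<^sub>j / (m choose j)) powr (1 / j)\<close> is non-increasing in \<open>j\<close>.\<close>

section \<open>Lower shadows and vertex links of set families\<close>

text \<open>In contrast to \<open>shadow_sets\<close>, no ambient vertex set is named: the operator
  is iterated and is also applied to links.\<close>

definition lower_shadow :: "nat \<Rightarrow> 'a set set \<Rightarrow> 'a set set" where
  "lower_shadow j F = {T. card T = j \<and> (\<exists>e\<in>F. T \<subseteq> e)}"

definition vertex_link :: "'a set set \<Rightarrow> 'a \<Rightarrow> 'a set set" where
  "vertex_link F v = (\<lambda>e. e - {v}) ` {e\<in>F. v \<in> e}"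

lemma finite_lower_shadow:
  assumes "finite F" "\<And>e. e \<in> F \<Longrightarrow> finite e"
  shows "finite (lower_shadow j F)"
proof (rule finite_subset)
  show "lower_shadow j F \<subseteq> Pow (\<Union>F)" by (auto simp: lower_shadow_def)
  show "finite (Pow (\<Union>F))" using assms by auto
qed

lemma lower_shadow_nonempty:
  assumes "F \<noteq> {}" "\<And>e. e \<in> F \<Longrightarrow> card e = s" "j \<le> s"
  shows "lower_shadow j F \<noteq> {}"
proof -
  obtain e where "e \<in> F" using assms by auto
  moreover obtain T where "T \<subseteq> e" "card T = j"
    using assms \<open>e \<in> F\<close> obtain_subset_with_card_n by metis
  ultimately show ?thesis by (auto simp: lower_shadow_def)
qed

lemma lower_shadow_lower_shadow:
  assumes "\<And>e. e \<in> F \<Longrightarrow> card e = s" "t \<le> p" "p \<le> s" "s > 0"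
  shows "lower_shadow t (lower_shadow p F) = lower_shadow t F"
proof -
  have "\<exists>U. card U = p \<and> (\<exists>e\<in>F. U \<subseteq> e) \<and> T \<subseteq> U" if T: "e \<in> F" "T \<subseteq> e" "card T = t" for e T
  proof -
    \<comment> \<open>Infinite sets have \<open>card\<close> 0, so it is \<open>s > 0\<close> that
      makes the edges finite.\<close>
    have "finite e" "card e = s" using assms T card_ge_0_finite by force+
    then obtain U where "T \<subseteq> U" "U \<subseteq> e" "card U = p"
      using exists_subset_between[of T p e] assms T by auto
    then show ?thesis using that by blast
  qed
  then have "lower_shadow t F \<subseteq> lower_shadow t (lower_shadow p F)"
    unfolding lower_shadow_def by simp blast
  moreover have "lower_shadow t (lower_shadow p F) \<subseteq> lower_shadow t F"
    unfolding lower_shadow_def by (auto dest: subset_trans)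
  ultimately show ?thesis by (rule antisym[rotated])
qed

lemma card_vertex_link: "card (vertex_link F v) = card {e\<in>F. v \<in> e}"
  unfolding vertex_link_def by (intro card_image) (auto simp: inj_on_def)

text \<open>Inserting \<open>v\<close> turns a set below the link into a member, one level higher,
  of the shadow of \<open>F\<close>. Links and shadows thus commute up to a shift of the level,
  which lets the induction read the shadow of a link inside the shadow of \<open>F\<close>.\<close>

lemma card_lower_shadow_vertex_link:
  assumes "\<And>e. e \<in> F \<Longrightarrow> finite e"
  shows "card (lower_shadow p (vertex_link F v)) = card {T \<in> lower_shadow (Suc p) F. v \<in> T}"
proof -
  have "lower_shadow p (vertex_link F v) = vertex_link (lower_shadow (Suc p) F) v"
  proof (intro set_eqI iffI)
    fix U assume "U \<in> lower_shadow p (vertex_link F v)"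
    then obtain e where e: "card U = p" "e \<in> F" "v \<in> e" "U \<subseteq> e - {v}"
      by (auto simp: lower_shadow_def vertex_link_def)
    then have "finite U" using assms finite_subset by blast
    then have "insert v U \<in> lower_shadow (Suc p) F" "U = insert v U - {v}"
      using e by (auto simp: lower_shadow_def card_insert_if)
    then show "U \<in> vertex_link (lower_shadow (Suc p) F) v"
      unfolding vertex_link_def by (intro image_eqI[where x = "insert v U"]) auto
  next
    fix U assume "U \<in> vertex_link (lower_shadow (Suc p) F) v"
    then obtain T e where "U = T - {v}" "v \<in> T" "card T = Suc p" "T \<subseteq> e" "e \<in> F"
      by (auto simp: lower_shadow_def vertex_link_def)
    then have "card U = p" "U \<subseteq> e - {v}" "e - {v} \<in> vertex_link F v"
      by (auto simp: vertex_link_def)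
    then show "U \<in> lower_shadow p (vertex_link F v)" by (auto simp: lower_shadow_def)
  qed
  then show ?thesis by (simp add: card_vertex_link)
qed

section \<open>The inequality between consecutive levels\<close>

text \<open>Double counting of the incidences between vertices and edges.\<close>

lemma sum_card_containing:
  assumes "finite F" "finite V" "\<And>e. e \<in> F \<Longrightarrow> e \<subseteq> V \<and> card e = s"
  shows "(\<Sum>v\<in>V. card {e\<in>F. v \<in> e}) = s * card F"
proof -
  have "(\<Sum>v\<in>V. card {e\<in>F. v \<in> e}) = (\<Sum>v\<in>V. \<Sum>e\<in>F. if v \<in> e then 1 else 0)"
    using assms by (intro sum.cong) (auto simp: sum.If_cases Int_def)
  also have "\<dots> = (\<Sum>e\<in>F. \<Sum>v\<in>V. if v \<in> e then 1 else 0)" by (rule sum.swap)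
  also have "\<dots> = (\<Sum>e\<in>F. s)"
  proof (intro sum.cong refl)
    fix e assume "e \<in> F"
    then have "V \<inter> {v. v \<in> e} = e" "card e = s" using assms by auto
    then show "(\<Sum>v\<in>V. if v \<in> e then 1 else 0) = s" using assms(2) by (simp add: sum.If_cases)
  qed
  finally show ?thesis by simp
qed

text \<open>The tangent line of the concave function \<open>x powr (1 / p)\<close> at \<open>\<mu>\<close>, multiplied out.\<close>

lemma le_tangent_power:
  fixes l q x \<mu> K :: real
  assumes "p > 0" "\<mu> > 0" "x \<ge> 0" "K \<ge> 0" "q \<ge> 0" "l \<le> x"
    and "l ^ (p - 1) \<le> K * q ^ p" and "l \<ge> 0"
  shows "l \<le> root p (K * \<mu>) * (q * (1 + (x - \<mu>) / (real p * \<mu>)))"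
proof -
  define y where "y = (x - \<mu>) / (real p * \<mu>)"
  have py: "real p * y = x / \<mu> - 1" using assms by (simp add: y_def field_simps)
  have y: "y \<ge> - 1"
  proof -
    have "- 1 \<le> real p * y" using py assms by simp
    moreover have "real p \<ge> 1" using assms by simp
    ultimately show ?thesis using mult_right_mono_neg[of 1 "real p" y] by (cases "y \<le> 0") auto
  qed
  \<comment> \<open>Bernoulli's inequality, since \<open>x / \<mu>\<close> is
    \<open>1 + real p * y\<close>. This is the tangent bound raised to the power
    \<open>p\<close>.\<close>
  have "x / \<mu> \<le> (1 + y) ^ p"
    using Bernoulli_inequality[OF y, of p] py by simp
  then have xm: "x \<le> \<mu> * (1 + y) ^ p" using assms by (simp add: field_simps)
  \<comment> \<open>The weighted geometric mean: one factor \<open>l\<close> is bounded by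
    \<open>x\<close>, the other \<open>p - 1\<close> by the assumption on
    \<open>l ^ (p - 1)\<close>.\<close>
  have "l ^ p = l * l ^ (p - 1)" using assms by (simp add: power_eq_if)
  also have "\<dots> \<le> x * (K * q ^ p)" using assms by (intro mult_mono) auto
  also have "\<dots> \<le> (\<mu> * (1 + y) ^ p) * (K * q ^ p)"
    using xm assms by (intro mult_right_mono) auto
  also have "\<dots> = (root p (K * \<mu>) * (q * (1 + y))) ^ p"
    using assms by (simp add: power_mult_distrib mult_ac)
  finally show ?thesis unfolding y_def[symmetric]
    using assms y by (simp add: power_mono_iff)
qed

text \<open>The algebra that ends the induction step. Absorption identities express both binomial
  coefficients of the conclusion through \<open>B\<close> and \<open>D\<close>. After division by
  \<open>(real m * D) ^ p\<close>, the bound in the assumption is exactly the right side of the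
  conclusion, so nothing is lost here.\<close>

lemma binomial_normalization:
  fixes a b :: real
  assumes p: "p > 0" and m: "m > p" and "a \<ge> 0" "b \<ge> 0"
    and le: "(real (Suc p) * a) ^ p \<le>
      real (m - 1 choose p) ^ (p - 1) / real (m - 1 choose (p - 1)) ^ p *
      (b * (real m - real p) / real m) * (real p * b) ^ p"
  shows "(a / real (m choose Suc p)) ^ p \<le> (b / real (m choose p)) ^ Suc p"
proof -
  obtain p' where p': "p = Suc p'" using p by (cases p) auto
  obtain m' where m': "m = Suc m'" using m by (cases m) auto
  define B where "B = real (m - 1 choose (p - 1))"
  define D where "D = real (m - 1 choose p)"
  have pos: "B > 0" "D > 0" using m p unfolding B_def D_def by (auto simp: m')
  have c1: "real (m choose Suc p) = real m * D / real (Suc p)"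
  proof -
    have "Suc p * (m choose Suc p) = m * (m - 1 choose p)"
      using binomial_absorption[of p m] by simp
    then show ?thesis unfolding D_def
      by (metis nonzero_mult_div_cancel_left of_nat_mult of_nat_neq_0)
  qed
  have c2: "real (m choose p) = real m * B / real p"
  proof -
    have "p * (m choose p) = m * (m - 1 choose (p - 1))"
      using binomial_absorption[of "p - 1" m] p by simp
    then show ?thesis unfolding B_def
      using p by (metis nonzero_mult_div_cancel_left of_nat_mult of_nat_0_eq_iff less_numeral_extra(3))
  qed
  have c3: "real p * D = (real m - real p) * B"
  proof -
    have "p * (m - 1 choose p) = (m - p) * (m - 1 choose (p - 1))"
      using binomial_absorption[of p' "m - 1"] binomial_absorb_comp[of "m - 1" p'] p' m' by simp
    then show ?thesis unfolding B_def D_def using m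
      by (metis less_imp_le of_nat_diff of_nat_mult)
  qed
  have m0: "real m > 0" using m by simp
  have "(a / real (m choose Suc p)) ^ p = (real (Suc p) * a) ^ p / (real m * D) ^ p"
    unfolding c1 by (simp add: power_divide power_mult_distrib)
  also have "\<dots> \<le> (D ^ (p - 1) / B ^ p * (b * (real m - real p) / real m) * (real p * b) ^ p)
      / (real m * D) ^ p"
    using le pos m0 unfolding B_def D_def by (intro divide_right_mono) auto
  also have "\<dots> = (b * real p / (real m * B)) ^ Suc p"
  proof -
    have "D ^ p = D * D ^ (p - 1)" using p by (simp add: power_eq_if)
    moreover have "real m - real p = real p * D / B" using c3 pos by (simp add: field_simps)
    ultimately show ?thesis using pos m0
      by (simp only: power_mult_distrib power_divide power_Suc) (simp add: divide_simps mult_ac)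
  qed
  finally show ?thesis unfolding c2 by simp
qed

text \<open>Induction over vertex links. The link of a vertex of colour \<open>c\<close> has at most as many edges
  as there are members of the shadow avoiding \<open>c\<close>; the induction hypothesis bounds the same number
  through the shadow of the link. A weighted geometric mean of both bounds is summed over all
  vertices, and Cauchy-Schwarz over the colour classes closes the estimate with the sharp constant.\<close>

lemma coloured_shadow_step:
  assumes "finite F" "F \<noteq> {}" "\<And>e. e \<in> F \<Longrightarrow> card e = Suc p \<and> inj_on c e \<and> c ` e \<subseteq> C" "finite C"
  shows "(real (card F) / real (card C choose Suc p)) ^ p
      \<le> (real (card (lower_shadow p F)) / real (card C choose p)) ^ Suc p"
  using assms
proof (induction p arbitrary: F C)
  \<comment> \<open>The left side is a zeroth power, hence 1, and it suffices that the shadow at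
    level 0 is nonempty.\<close>
  case 0
  have "lower_shadow 0 F \<noteq> {}" by (rule lower_shadow_nonempty[of F 1]) (use 0 in auto)
  moreover have "finite (lower_shadow 0 F)"
    by (rule finite_lower_shadow) (use 0 card_ge_0_finite in force)+
  ultimately have "card (lower_shadow 0 F) > 0" by (simp add: card_gt_0_iff)
  then show ?case by simp
next
  case (Suc p')
  define p where "p = Suc p'"
  define V where "V = \<Union>F"
  define m where "m = card C"
  define Sh where "Sh = lower_shadow p F"
  define b where "b = real (card Sh)"
  define l where "l v = real (card {e\<in>F. v \<in> e})" for v
  define q where "q v = real (card {T\<in>Sh. v \<in> T})" for v
  define G where "G h = real (card {T\<in>Sh. h \<in> c ` T})" for h
  have edge: "card e = Suc p" "inj_on c e" "c ` e \<subseteq> C" "finite e" if "e \<in> F" for e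
    using Suc.prems(3)[OF that] card_ge_0_finite[of e] by (auto simp: p_def)
  have fin: "finite V" "finite Sh" unfolding V_def Sh_def
    using Suc.prems(1) edge by (auto intro: finite_lower_shadow)
  have Sh: "T \<subseteq> V" "card T = p" "inj_on c T" "c ` T \<subseteq> C" if T: "T \<in> Sh" for T
  proof -
    obtain e where e: "e \<in> F" "T \<subseteq> e" "card T = p" using T by (auto simp: Sh_def lower_shadow_def)
    then show "T \<subseteq> V" "card T = p" by (auto simp: V_def)
    show "inj_on c T" using e edge inj_on_subset by blast
    show "c ` T \<subseteq> C" using e edge by blast
  qed
  have m: "m > p"
  proof -
    obtain e where e: "e \<in> F" using Suc.prems by auto
    have "Suc p = card (c ` e)" using edge[OF e] by (simp add: card_image)
    also have "\<dots> \<le> m" unfolding m_def using edge[OF e] Suc.prems by (intro card_mono) auto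
    finally show ?thesis by simp
  qed
  have b: "b > 0"
  proof -
    have "Sh \<noteq> {}" unfolding Sh_def
      by (rule lower_shadow_nonempty[of F "Suc p"]) (use Suc.prems edge in auto)
    then show ?thesis using fin by (simp add: b_def card_gt_0_iff)
  qed
  have suml: "(\<Sum>v\<in>V. l v) = real (Suc p) * real (card F)"
  proof -
    have "(\<Sum>v\<in>V. card {e\<in>F. v \<in> e}) = Suc p * card F"
      using Suc.prems(1) fin(1) edge(1) by (intro sum_card_containing) (auto simp: V_def)
    then show ?thesis unfolding l_def of_nat_sum[symmetric] of_nat_mult[symmetric] by (simp only:)
  qed
  have sumq: "(\<Sum>v\<in>V. q v) = real p * b"
  proof -
    have "(\<Sum>v\<in>V. card {T\<in>Sh. v \<in> T}) = p * card Sh"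
      using fin Sh(1,2) by (intro sum_card_containing) auto
    then show ?thesis unfolding q_def b_def of_nat_sum[symmetric] of_nat_mult[symmetric] by (simp only:)
  qed
  have cV: "c ` V \<subseteq> C" using edge(3) unfolding V_def by blast
  \<comment> \<open>Members of \<open>Sh\<close> contain at most one vertex of each colour, so those
    through different vertices of colour \<open>h\<close> form disjoint families.\<close>
  have Gq: "(\<Sum>v\<in>{v\<in>V. c v = h}. q v) = G h" for h
  proof -
    have "(\<Sum>v\<in>{v\<in>V. c v = h}. card {T\<in>Sh. v \<in> T}) = card (\<Union>v\<in>{v\<in>V. c v = h}. {T\<in>Sh. v \<in> T})"
      using fin by (intro card_UN_disjoint[symmetric]) (auto dest: Sh(3) inj_onD)
    also have "(\<Union>v\<in>{v\<in>V. c v = h}. {T\<in>Sh. v \<in> T}) = {T\<in>Sh. h \<in> c ` T}"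
      using Sh(1) by auto
    finally show ?thesis unfolding q_def G_def of_nat_sum[symmetric] by (simp only:)
  qed
  have sumG: "(\<Sum>h\<in>C. G h) = real p * b"
    unfolding Gq[symmetric] sumq[symmetric] using fin Suc.prems cV by (intro sum.group) auto
  have sumqG: "(\<Sum>v\<in>V. q v * G (c v)) = (\<Sum>h\<in>C. (G h)\<^sup>2)"
  proof -
    have "(\<Sum>v\<in>V. q v * G (c v)) = (\<Sum>h\<in>C. \<Sum>v\<in>{v\<in>V. c v = h}. q v * G (c v))"
      using fin Suc.prems cV by (intro sum.group[symmetric]) auto
    also have "\<dots> = (\<Sum>h\<in>C. (\<Sum>v\<in>{v\<in>V. c v = h}. q v) * G h)"
      by (simp add: sum_distrib_right)
    finally show ?thesis by (simp add: Gq power2_eq_square)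
  qed
  have CS: "(real p * b)\<^sup>2 \<le> real m * (\<Sum>h\<in>C. (G h)\<^sup>2)"
    using sum_squared_le_sum_of_squares[of G C] Suc.prems sumG by (simp add: m_def mult.commute)
  \<comment> \<open>By \<open>sumG\<close>, \<open>\<mu>\<close> is the mean of
    \<open>b - G h\<close> over the \<open>m\<close> colours. Touching at this point keeps the
    constant sharp when all colours are equally frequent.\<close>
  define \<mu> where "\<mu> = b * (real m - real p) / real m"
  \<comment> \<open>The induction hypothesis for a link, solved for \<open>l v ^ (p - 1)\<close>,
    yields this factor.\<close>
  define K where "K = real (m - 1 choose p) ^ (p - 1) / real (m - 1 choose (p - 1)) ^ p"
  define A where "A = root p (K * \<mu>)"
  have \<mu>: "\<mu> > 0" using b m by (simp add: \<mu>_def)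
  have K: "K \<ge> 0" by (simp add: K_def)
  have p0: "p > 0" by (simp add: p_def)
  have lv: "l v \<le> A * (q v * (1 + (b - G (c v) - \<mu>) / (real p * \<mu>)))" if v: "v \<in> V" for v
    unfolding A_def
  proof (rule le_tangent_power)
    have "card {e\<in>F. v \<in> e} \<le> card {T\<in>Sh. c v \<notin> c ` T}"
    proof -
      have "vertex_link F v \<subseteq> {T\<in>Sh. c v \<notin> c ` T}"
      proof
        fix T assume "T \<in> vertex_link F v"
        then obtain e where e: "e \<in> F" "v \<in> e" "T = e - {v}" by (auto simp: vertex_link_def)
        then have "card T = p" using edge(1,4) by simp
        then have "T \<in> Sh" using e by (auto simp: Sh_def lower_shadow_def)
        moreover have "c v \<notin> c ` T" using edge(2)[OF e(1)] e by (auto dest: inj_onD)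
        ultimately show "T \<in> {T\<in>Sh. c v \<notin> c ` T}" by simp
      qed
      then show ?thesis using fin card_mono[of "{T\<in>Sh. c v \<notin> c ` T}"] by (simp flip: card_vertex_link)
    qed
    moreover have "card {T\<in>Sh. c v \<notin> c ` T} + card {T\<in>Sh. c v \<in> c ` T} = card Sh"
      using fin by (subst card_Un_disjoint[symmetric]) (auto intro: arg_cong[where f = card])
    ultimately show "l v \<le> b - G (c v)" unfolding l_def b_def G_def by linarith
    have "card {T\<in>Sh. c v \<in> c ` T} \<le> card Sh" using fin by (intro card_mono) auto
    then show "b - G (c v) \<ge> 0" by (simp add: b_def G_def)
    have ne: "vertex_link F v \<noteq> {}" using v by (auto simp: V_def vertex_link_def)
    have cv: "c v \<in> C" using v cV by auto
    \<comment> \<open>The colour of \<open>v\<close> does not recur in its link, so one colour fewer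
      is available; hence \<open>m - 1\<close> in \<open>K\<close>.\<close>
    have "(real (card (vertex_link F v)) / real (card (C - {c v}) choose Suc p')) ^ p'
      \<le> (real (card (lower_shadow p' (vertex_link F v))) / real (card (C - {c v}) choose p')) ^ Suc p'"
    proof (rule Suc.IH)
      fix T assume "T \<in> vertex_link F v"
      then obtain e where e: "e \<in> F" "v \<in> e" "T = e - {v}" by (auto simp: vertex_link_def)
      then show "card T = Suc p' \<and> inj_on c T \<and> c ` T \<subseteq> C - {c v}"
        using edge[OF e(1)] by (auto simp: p_def dest: inj_onD intro: inj_on_subset)
    qed (use ne Suc.prems in \<open>auto simp: vertex_link_def\<close>)
    moreover have "card (lower_shadow p' (vertex_link F v)) = card {T\<in>Sh. v \<in> T}"
      unfolding Sh_def p_def using edge(4) by (rule card_lower_shadow_vertex_link)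
    ultimately have "(l v / real (m - 1 choose p)) ^ (p - 1) \<le> (q v / real (m - 1 choose (p - 1))) ^ p"
      using cv Suc.prems by (simp add: card_vertex_link l_def q_def m_def p_def)
    moreover have "real (m - 1 choose p) > 0" using m by simp
    ultimately show "l v ^ (p - 1) \<le> K * q v ^ p"
      unfolding K_def by (simp add: power_divide field_simps)
  qed (use p0 \<mu> K in \<open>auto simp: q_def l_def\<close>)
  have A: "A \<ge> 0" unfolding A_def using K \<mu> p0 by (intro real_root_ge_zero mult_nonneg_nonneg) auto
  have "real (Suc p) * real (card F) \<le> (\<Sum>v\<in>V. A * (q v * (1 + (b - G (c v) - \<mu>) / (real p * \<mu>))))"
    unfolding suml[symmetric] using lv by (rule sum_mono)
  also have "\<dots> = A * ((\<Sum>v\<in>V. q v) + ((b - \<mu>) * (\<Sum>v\<in>V. q v) - (\<Sum>v\<in>V. q v * G (c v))) / (real p * \<mu>))"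
    by (simp add: sum_distrib_left sum_subtractf sum_divide_distrib algebra_simps sum.distrib
        diff_divide_distrib add_divide_distrib)
  \<comment> \<open>The linear correction is nonpositive: \<open>b - \<mu>\<close> equals
    \<open>real p * b / real m\<close>, and \<open>CS\<close> bounds the resulting square by the sum
    of the squares of \<open>G h\<close>.\<close>
  also have "\<dots> \<le> A * (real p * b)"
  proof -
    have "(b - \<mu>) * (real p * b) = (real p * b)\<^sup>2 / real m"
      using m by (simp add: \<mu>_def power2_eq_square field_simps)
    also have "\<dots> \<le> (\<Sum>h\<in>C. (G h)\<^sup>2)" using CS m by (simp add: field_simps)
    finally have "((b - \<mu>) * (real p * b) - (\<Sum>h\<in>C. (G h)\<^sup>2)) / (real p * \<mu>) \<le> 0"
      using \<mu> p0 by (intro divide_nonpos_nonneg) auto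
    then show ?thesis unfolding sumq sumqG using A by (intro mult_left_mono) auto
  qed
  finally have "(real (Suc p) * real (card F)) ^ p \<le> (A * (real p * b)) ^ p"
    by (intro power_mono) auto
  also have "\<dots> = K * \<mu> * (real p * b) ^ p"
    unfolding power_mult_distrib A_def using p0 K \<mu> by simp
  finally have "(real (card F) / real (m choose Suc p)) ^ p \<le> (b / real (m choose p)) ^ Suc p"
    unfolding K_def \<mu>_def using p0 m b by (intro binomial_normalization) auto
  then show ?case unfolding m_def b_def Sh_def p_def .
qed

section \<open>The inequality between arbitrary levels\<close>

lemma powr_inverse_power:
  fixes x :: real
  assumes "x \<ge> 0" "n > 0"
  shows "(x powr (1 / real n)) ^ n = x"
  using assms by (cases "x = 0") (simp_all add: powr_powr flip: powr_realpow)

lemma power_powr_inverse: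
  fixes x :: real
  assumes "x \<ge> 0" "n > 0"
  shows "(x ^ n) powr (1 / real n) = x"
  using assms by (cases "x = 0") (simp_all add: powr_powr flip: powr_realpow)

text \<open>The inequality for consecutive levels is put in root form and chained from level
  \<open>s\<close> down to level \<open>t\<close>; every intermediate shadow is still injectively
  coloured from \<open>C\<close>.\<close>

theorem coloured_kruskal_katona:
  assumes "finite F" "F \<noteq> {}" "\<And>e. e \<in> F \<Longrightarrow> card e = s \<and> inj_on c e \<and> c ` e \<subseteq> C" "finite C"
    and "1 \<le> t" "t \<le> s"
  shows "(real (card F) / real (card C choose s)) powr (1 / real s)
      \<le> (real (card (lower_shadow t F)) / real (card C choose t)) powr (1 / real t)"
  using assms(6,1-5)
proof (induction s arbitrary: F rule: dec_induct)
  case base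
  have "lower_shadow t F = F"
  proof
    show "lower_shadow t F \<subseteq> F"
    proof
      fix T assume "T \<in> lower_shadow t F"
      then obtain e where e: "card T = t" "T \<subseteq> e" "e \<in> F" by (auto simp: lower_shadow_def)
      then have "card e = t" "finite e" using base card_ge_0_finite[of e] by auto
      then show "T \<in> F" using e card_subset_eq by metis
    qed
  qed (use base in \<open>auto simp: lower_shadow_def\<close>)
  then show ?case by simp
next
  case (step p)
  have fe: "finite e" "card e = Suc p" if "e \<in> F" for e
    using step.prems(3)[OF that] card_ge_0_finite[of e] by auto
  define x where "x = real (card F) / real (card C choose Suc p)"
  define y where "y = real (card (lower_shadow p F)) / real (card C choose p)"
  have p0: "p > 0" using step by simp
  have xy: "x \<ge> 0" "y \<ge> 0" by (auto simp: x_def y_def)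
  have "x ^ p \<le> y ^ Suc p" unfolding x_def y_def using step.prems by (intro coloured_shadow_step) auto
  \<comment> \<open>The two roots commute, so each side cancels its own power and keeps the other
    root.\<close>
  then have "root (Suc p) (root p (x ^ p)) \<le> root p (root (Suc p) (y ^ Suc p))"
    using p0 by (simp add: real_root_commute[of "Suc p" p] del: power_Suc)
  then have "root (Suc p) x \<le> root p y"
    using p0 xy by (simp only: real_root_power_cancel zero_less_Suc)
  then have "x powr (1 / real (Suc p)) \<le> y powr (1 / real p)"
    using p0 xy by (simp only: root_powr_inverse zero_less_Suc)
  also have "\<dots> \<le> (real (card (lower_shadow t (lower_shadow p F))) / real (card C choose t)) powr (1 / real t)"
    unfolding y_def
  proof (rule step.IH)
    show "finite (lower_shadow p F)" using step.prems fe by (auto intro: finite_lower_shadow)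
    show "lower_shadow p F \<noteq> {}" by (rule lower_shadow_nonempty[of F "Suc p"]) (use step.prems fe in auto)
    fix T assume "T \<in> lower_shadow p F"
    then obtain e where e: "card T = p" "T \<subseteq> e" "e \<in> F" by (auto simp: lower_shadow_def)
    then show "card T = p \<and> inj_on c T \<and> c ` T \<subseteq> C"
      using step.prems(3)[OF e(3)] by (auto intro: inj_on_subset)
  qed (use step in auto)
  also have "lower_shadow t (lower_shadow p F) = lower_shadow t F"
    by (rule lower_shadow_lower_shadow[of F "Suc p"]) (use fe step in auto)
  finally show ?case unfolding x_def .
qed

section \<open>Colourings and degrees under passage to a lower shadow\<close>

lemma rgraph_lower_shadow:
  assumes "rgraph r V E"
  shows "rgraph t V (lower_shadow t E)"
  using assms unfolding rgraph_def lower_shadow_def by blast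

lemma no_isolated_lower_shadow:
  assumes "rgraph r V E" "no_isolated V E" "1 \<le> t" "t \<le> r"
  shows "no_isolated V (lower_shadow t E)"
  unfolding no_isolated_def
proof
  fix v assume "v \<in> V"
  then obtain e where e: "e \<in> E" "v \<in> e" using assms by (auto simp: no_isolated_def)
  have "finite e" "card e = r" using e assms by (auto simp: rgraph_def intro: finite_subset)
  then obtain T where "{v} \<subseteq> T" "T \<subseteq> e" "card T = t"
    using exists_subset_between[of "{v}" t e] e assms by auto
  then show "\<exists>T\<in>lower_shadow t E. v \<in> T" using e by (auto simp: lower_shadow_def)
qed

text \<open>Injectivity is a condition on pairs, and for \<open>t \<ge> 2\<close> any two vertices
  of an edge share a \<open>t\<close>-subset of that edge.\<close>

lemma is_coloring_lower_shadow:
  assumes "rgraph r V E" "2 \<le> t" "t \<le> r"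
  shows "is_coloring k V (lower_shadow t E) \<phi> \<longleftrightarrow> is_coloring k V E \<phi>"
proof -
  have "inj_on \<phi> e" if e: "e \<in> E" and inj: "\<forall>T\<in>lower_shadow t E. inj_on \<phi> T" for e
  proof (rule inj_onI, rule ccontr)
    fix x y assume xy: "x \<in> e" "y \<in> e" "\<phi> x = \<phi> y" "x \<noteq> y"
    have "finite e" "card e = r" using e assms by (auto simp: rgraph_def intro: finite_subset)
    then obtain T where T: "{x, y} \<subseteq> T" "T \<subseteq> e" "card T = t"
      using exists_subset_between[of "{x, y}" t e] xy assms by auto
    then have "inj_on \<phi> T" using e inj by (auto simp: lower_shadow_def)
    then show False using T xy by (auto dest: inj_onD)
  qed
  moreover have "inj_on \<phi> T" if "T \<in> lower_shadow t E" "\<forall>e\<in>E. inj_on \<phi> e" for T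
    using that unfolding lower_shadow_def by (blast intro: inj_on_subset)
  ultimately show ?thesis unfolding is_coloring_def by blast
qed

lemma uniquely_colorable_lower_shadow:
  assumes "rgraph r V E" "2 \<le> t" "t \<le> r"
  shows "uniquely_colorable k V (lower_shadow t E) \<longleftrightarrow> uniquely_colorable k V E"
  unfolding uniquely_colorable_def k_partite_def is_coloring_lower_shadow[OF assms] ..

lemma shadow_sets_lower_shadow:
  assumes "rgraph r V E" "i \<le> t" "t \<le> r"
  shows "shadow_sets i V (lower_shadow t E) = shadow_sets i V E"
proof -
  have "\<exists>T\<in>lower_shadow t E. S \<subseteq> T" if S: "card S = i" "e \<in> E" "S \<subseteq> e" for S e
  proof -
    have "finite e" "card e = r" using that assms by (auto simp: rgraph_def intro: finite_subset)
    then obtain T where "S \<subseteq> T" "T \<subseteq> e" "card T = t"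
      using exists_subset_between[of S t e] S assms by auto
    then show ?thesis using that by (auto simp: lower_shadow_def)
  qed
  moreover have "\<exists>e\<in>E. S \<subseteq> e" if "T \<in> lower_shadow t E" "S \<subseteq> T" for S T
    using that by (auto simp: lower_shadow_def)
  ultimately have "(\<exists>T\<in>lower_shadow t E. S \<subseteq> T) \<longleftrightarrow> (\<exists>e\<in>E. S \<subseteq> e)" if "card S = i" for S
    using that by metis
  then show ?thesis unfolding shadow_sets_def by (intro Collect_cong conj_cong) auto
qed

lemma finite_shadow_sets: "rgraph r V E \<Longrightarrow> finite (shadow_sets i V E)"
  by (rule finite_subset[of _ "Pow V"]) (auto simp: shadow_sets_def rgraph_def)

lemma shadow_sets_nonempty:
  assumes "rgraph r V E" "no_isolated V E" "V \<noteq> {}" "i \<le> r"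
  shows "shadow_sets i V E \<noteq> {}"
proof -
  obtain e where e: "e \<in> E" using assms by (auto simp: no_isolated_def)
  then have "card e = r" "e \<subseteq> V" using assms by (auto simp: rgraph_def)
  then obtain S where "S \<subseteq> e" "card S = i" using assms by (metis obtain_subset_with_card_n)
  then show ?thesis using e \<open>e \<subseteq> V\<close> by (auto simp: shadow_sets_def)
qed

text \<open>A colouring of the whole graph spends \<open>i\<close> colours on an \<open>i\<close>-set \<open>S\<close>, so only \<open>k - i\<close>
  colours remain for the link of \<open>S\<close>.\<close>

lemma set_degree_lower_shadow:
  assumes rg: "rgraph r V E" and col: "is_coloring k V E \<phi>" and S: "S \<in> shadow_sets i V E"
    and "i < t" "t \<le> r"
  shows "(real (set_degree r V E S) / real (k - i choose (r - i))) powr (1 / real (r - i))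
    \<le> (real (set_degree t V (lower_shadow t E) S) / real (k - i choose (t - i))) powr (1 / real (t - i))"
proof -
  define L where "L = {T. T \<subseteq> V \<and> card T = r - card S \<and> S \<inter> T = {} \<and> S \<union> T \<in> E}"
  obtain e where e: "e \<in> E" "S \<subseteq> e" and S': "card S = i" "S \<subseteq> V"
    using S by (auto simp: shadow_sets_def)
  have fV: "finite V" and eV: "e \<subseteq> V" "card e = r" using rg e by (auto simp: rgraph_def)
  have finS: "finite S" using fV S' finite_subset by blast
  have finL: "finite L" by (rule finite_subset[of _ "Pow V"]) (auto simp: L_def fV)
  have "e - S \<in> L"
    using e eV S' finS by (auto simp: L_def card_Diff_subset Un_absorb1 intro: subsetD)
  then have neL: "L \<noteq> {}" by auto
  define C where "C = {1..k} - \<phi> ` S"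
  have "\<phi> ` S \<subseteq> {1..k}" using col S' by (auto simp: is_coloring_def)
  moreover have "inj_on \<phi> S" using col e inj_on_subset[of \<phi> e S] by (auto simp: is_coloring_def)
  ultimately have C: "card C = k - i"
    unfolding C_def using S' finS by (simp add: card_Diff_subset card_image)
  have "(real (card L) / real (card C choose (r - i))) powr (1 / real (r - i))
    \<le> (real (card (lower_shadow (t - i) L)) / real (card C choose (t - i))) powr (1 / real (t - i))"
  proof (rule coloured_kruskal_katona)
    fix T assume T: "T \<in> L"
    have inj: "inj_on \<phi> (S \<union> T)" using T col by (auto simp: L_def is_coloring_def)
    then have "inj_on \<phi> T" by (rule inj_on_subset) auto
    moreover have "\<phi> ` T \<subseteq> {1..k}" using T col by (auto simp: L_def is_coloring_def)
    moreover have "\<phi> ` T \<inter> \<phi> ` S = {}"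
      using inj_on_image_Int[OF inj, of T S] T by (auto simp: L_def)
    ultimately show "card T = r - i \<and> inj_on \<phi> T \<and> \<phi> ` T \<subseteq> C"
      using T S' by (auto simp: L_def C_def)
  qed (use finL neL assms in \<open>auto simp: C_def\<close>)
  also have "\<dots> \<le> (real (set_degree t V (lower_shadow t E) S) / real (card C choose (t - i))) powr (1 / real (t - i))"
  proof -
    \<comment> \<open>The degree in the lower shadow is to be bounded from below, so one inclusion
      suffices.\<close>
    have "lower_shadow (t - i) L
        \<subseteq> {T. T \<subseteq> V \<and> card T = t - card S \<and> S \<inter> T = {} \<and> S \<union> T \<in> lower_shadow t E}"
    proof
      fix U assume "U \<in> lower_shadow (t - i) L"
      then obtain T where U: "card U = t - i" "U \<subseteq> T" and T: "T \<subseteq> V" "S \<inter> T = {}" "S \<union> T \<in> E"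
        by (auto simp: lower_shadow_def L_def)
      have "finite U" using U T fV by (meson finite_subset)
      moreover have "S \<inter> U = {}" using U T by auto
      ultimately have "card (S \<union> U) = t" using finS U S' assms by (simp add: card_Un_disjoint)
      then have "S \<union> U \<in> lower_shadow t E" using U T by (auto simp: lower_shadow_def)
      then show "U \<in> {T. T \<subseteq> V \<and> card T = t - card S \<and> S \<inter> T = {} \<and> S \<union> T \<in> lower_shadow t E}"
        using U T S' by auto
    qed
    then have "card (lower_shadow (t - i) L) \<le> set_degree t V (lower_shadow t E) S"
      unfolding set_degree_def using fV by (intro card_mono) auto
    then show ?thesis by (intro powr_mono2 divide_right_mono) auto
  qed
  finally show ?thesis unfolding C by (simp add: L_def set_degree_def)
qed

text \<open>Both minima range over the same \<open>i\<close>-sets. A minimiser \<open>S\<close> for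
  the lower shadow is chosen, and its degree in \<open>E\<close> is at least the minimum
  there.\<close>

lemma pos_min_degree_lower_shadow:
  assumes rg: "rgraph r V E" and "k_partite k V E" and "no_isolated V E" "V \<noteq> {}"
    and "i < t" "t \<le> r"
  shows "(real (pos_min_degree r i V E) / real (k - i choose (r - i))) powr (1 / real (r - i))
    \<le> (real (pos_min_degree t i V (lower_shadow t E)) / real (k - i choose (t - i))) powr (1 / real (t - i))"
proof -
  obtain \<phi> where \<phi>: "is_coloring k V E \<phi>" using assms by (auto simp: k_partite_def)
  have sh: "shadow_sets i V (lower_shadow t E) = shadow_sets i V E"
    using assms by (intro shadow_sets_lower_shadow) auto
  have fin: "finite (shadow_sets i V E)" using rg by (rule finite_shadow_sets)
  have "shadow_sets i V E \<noteq> {}" using assms by (intro shadow_sets_nonempty) auto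
  then have "pos_min_degree t i V (lower_shadow t E) \<in> set_degree t V (lower_shadow t E) ` shadow_sets i V E"
    unfolding pos_min_degree_def sh using fin by (intro Min_in) auto
  then obtain S where S: "S \<in> shadow_sets i V E"
    "pos_min_degree t i V (lower_shadow t E) = set_degree t V (lower_shadow t E) S" by auto
  have "pos_min_degree r i V E \<le> set_degree r V E S"
    unfolding pos_min_degree_def using fin S by (intro Min_le) auto
  then have "(real (pos_min_degree r i V E) / real (k - i choose (r - i))) powr (1 / real (r - i))
    \<le> (real (set_degree r V E S) / real (k - i choose (r - i))) powr (1 / real (r - i))"
    by (intro powr_mono2 divide_right_mono) auto
  also have "\<dots> \<le> (real (set_degree t V (lower_shadow t E) S) / real (k - i choose (t - i))) powr (1 / real (t - i))"
    using set_degree_lower_shadow[OF rg \<phi> S(1)] assms by auto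
  finally show ?thesis by (simp add: S(2))
qed

section \<open>Comparison of the thresholds\<close>

text \<open>Every degree exceeds a negative threshold, so the example of a graph that is not
  uniquely colourable excludes one. This lets \<open>powr\<close> act as a genuine root on the
  normalised thresholds.\<close>

lemma Phi_nonneg:
  assumes "k \<ge> r" "r > i" "i \<ge> 1"
  shows "Phi k r i \<ge> 0"
proof (rule ccontr)
  assume neg: "\<not> Phi k r i \<ge> 0"
  obtain V :: "nat set" and E where VE: "rgraph r V E" "card V \<ge> k" "k_partite k V E" "no_isolated V E"
    "\<not> uniquely_colorable k V E"
    using ex_not_uniquely_colorable[of r k] assms by auto
  have "Phi k r i * real (card V) ^ (r - i) < 0"
    using neg VE(2) assms by (intro mult_neg_pos zero_less_power) auto
  also have "\<dots> \<le> real (pos_min_degree r i V E)" by simp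
  finally show False
    using Phi_is_minimum(1)[OF assms] VE unfolding forces_unique_def by blast
qed

theorem theorem1p3:
  fixes k r1 r2 i :: nat
  assumes "k \<ge> r1" and "r1 \<ge> r2" and "r2 > i" and "i \<ge> 1"
  shows "(Phi k r1 i / real ((k - i) choose (r1 - i))) powr (1 / real (r1 - i))
       \<le> (Phi k r2 i / real ((k - i) choose (r2 - i))) powr (1 / real (r2 - i))"
proof -
  define s t where "s = r1 - i" and "t = r2 - i"
  define B D where "B = real ((k - i) choose s)" and "D = real ((k - i) choose t)"
  define R where "R = (Phi k r2 i / D) powr (1 / real t)"
  have pos: "s > 0" "t > 0" "B > 0" "D > 0" using assms by (auto simp: s_def t_def B_def D_def)
  have R: "R \<ge> 0" by (simp add: R_def)
  have Phi2: "Phi k r2 i \<ge> 0" and Phi1: "Phi k r1 i \<ge> 0"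
    using assms by (auto intro: Phi_nonneg)
  have Rt: "R ^ t = Phi k r2 i / D"
    using pos Phi2 by (simp add: R_def powr_inverse_power)
  \<comment> \<open>\<open>R\<close> is the right side of the claim, and \<open>B * R ^ s\<close> is
    the value of \<open>Phi k r1 i\<close> at which both sides would agree. By minimality it is
    enough that this value forces uniqueness.\<close>
  have "forces_unique k r1 i (B * R ^ s)"
    unfolding forces_unique_def
  proof (intro allI impI, elim conjE)
    fix n and V :: "nat set" and E
    assume n: "n \<ge> k" and rg: "rgraph r1 V E" and card: "card V = n" and kp: "k_partite k V E"
      and iso: "no_isolated V E" and deg: "real (pos_min_degree r1 i V E) > B * R ^ s * real n ^ (r1 - i)"
    define E' where "E' = lower_shadow r2 E"
    have "V \<noteq> {}" using n card assms by auto
    \<comment> \<open>The degree assumption is carried to \<open>E'\<close> in normalised form. Its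
      strictness has to survive, because \<open>forces_unique\<close> asks for a strict
      inequality.\<close>
    have "R * real n = ((R * real n) ^ s) powr (1 / real s)"
      using R pos by (simp add: power_powr_inverse)
    also have "\<dots> < (real (pos_min_degree r1 i V E) / B) powr (1 / real s)"
      using deg pos R by (intro powr_less_mono2) (auto simp: s_def power_mult_distrib field_simps)
    also have "\<dots> \<le> (real (pos_min_degree r2 i V E') / D) powr (1 / real t)"
      unfolding B_def D_def s_def t_def E'_def
      using rg kp iso \<open>V \<noteq> {}\<close> assms by (intro pos_min_degree_lower_shadow) auto
    finally have "(R * real n) ^ t < ((real (pos_min_degree r2 i V E') / D) powr (1 / real t)) ^ t"
      using R pos by (intro power_strict_mono) auto
    also have "\<dots> = real (pos_min_degree r2 i V E') / D"
      using pos by (simp add: powr_inverse_power)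
    finally have "real (pos_min_degree r2 i V E') > Phi k r2 i * real n ^ (r2 - i)"
      using pos by (simp add: power_mult_distrib Rt t_def[symmetric] field_simps)
    moreover have "rgraph r2 V E'" "no_isolated V E'" "k_partite k V E'"
      using rg iso kp assms is_coloring_lower_shadow[OF rg, of r2] unfolding E'_def k_partite_def
      by (auto intro: rgraph_lower_shadow no_isolated_lower_shadow)
    ultimately have "uniquely_colorable k V E'"
      using Phi_is_minimum(1)[of r2 k i] assms n card unfolding forces_unique_def by auto
    then show "uniquely_colorable k V E"
      unfolding E'_def using uniquely_colorable_lower_shadow[OF rg] assms by auto
  qed
  then have "Phi k r1 i \<le> B * R ^ s" using Phi_is_minimum(2)[of r1 k i] assms by auto
  then have "(Phi k r1 i / B) powr (1 / real s) \<le> (R ^ s) powr (1 / real s)"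
    using pos Phi1 by (intro powr_mono2) (auto simp: field_simps)
  also have "\<dots> = R" using pos R by (simp add: power_powr_inverse)
  finally show ?thesis by (simp add: R_def B_def D_def s_def t_def)
qed

end
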